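(* $$\lim_{(s_1,s_2,s_3)\rightarrow (1,1,1)}(s_1+s_2+s_3-3)\,\zeta_{\mathfrak{S}}(s_1,s_2,s_3)=\frac{\pi^2}{4}.$$
   Context: For $\mathrm{Re}(s_1),\mathrm{Re}(s_2),\mathrm{Re}(s_3)>1$ the symmetric zeta function is defined by the absolutely convergent series $$\zeta_{\mathfrak{S}}(s_1,s_2,s_3)=\sum_{n_1,n_2,n_3\geq 1}\frac{1}{(n_1+n_2)^{s_1}(n_2+n_3)^{s_2}(n_3+n_1)^{s_3}}.$$ It has an analytic continuation to a meromorphic function on $\mathbb{C}^3$, with only simple poles, located along the hyperplanes $s_1+s_2=2-k$, $s_2+s_3=2-k$, $s_3+s_1=2-k$, $s_1+s_2+s_3=4-k$ ($k\geq 1$ an integer); $\zeta_{\mathfrak{S}}$ denotes this continuation. The limit is taken over $(s_1,s_2,s_3)\in\mathbb{C}^3$ tending to $(1,1,1)$ with $s_1+s_2+s_3\neq 3$. *)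

theory Defs
  imports "HOL-Analysis.Analysis"
begin

type_synonym complex3 = "complex \<times> complex \<times> complex"

text \<open>Complex differentiability in three variables: the Frechet derivative exists and is
  complex linear. The derivative is taken in the ambient space, so \<open>U\<close> is meant to be open.\<close>

definition holomorphic3_on :: "(complex3 \<Rightarrow> complex) \<Rightarrow> complex3 set \<Rightarrow> bool" where
  "holomorphic3_on f U \<longleftrightarrow>
     (\<forall>p\<in>U. \<exists>a b c. (f has_derivative (\<lambda>(h1, h2, h3). a * h1 + b * h2 + c * h3)) (at p))"

definition symmetric_zeta_series :: "complex3 \<Rightarrow> complex" where
  "symmetric_zeta_series = (\<lambda>(s1, s2, s3).
     \<Sum>\<^sub>\<infinity>(n1, n2, n3) \<in> {1::nat..} \<times> {1::nat..} \<times> {1::nat..}.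
       1 / (of_nat (n1 + n2) powr s1 * of_nat (n2 + n3) powr s2 * of_nat (n3 + n1) powr s3))"

text \<open>The possible polar hyperplanes, each given by the affine form vanishing on it.\<close>

definition polar_forms :: "(complex3 \<Rightarrow> complex) set" where
  "polar_forms = (\<Union>k\<in>{1::nat..}.
     {\<lambda>(s1, s2, s3). s1 + s2 - (2 - of_nat k),
      \<lambda>(s1, s2, s3). s2 + s3 - (2 - of_nat k),
      \<lambda>(s1, s2, s3). s3 + s1 - (2 - of_nat k),
      \<lambda>(s1, s2, s3). s1 + s2 + s3 - (4 - of_nat k)})"

definition polar_set :: "complex3 set" where
  "polar_set = {s. \<exists>l\<in>polar_forms. l s = 0}"

text \<open>\<open>Z\<close> is meromorphic with at most simple poles, along the polar hyperplanes only: it is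
  holomorphic off them, and near every point \<open>p\<close> multiplication by the forms of the (at most
  four) hyperplanes through \<open>p\<close>, each to the first power, makes it holomorphic.
  The values of \<open>Z\<close> on the polar set itself are irrelevant.\<close>

definition simple_polar_meromorphic :: "(complex3 \<Rightarrow> complex) \<Rightarrow> bool" where
  "simple_polar_meromorphic Z \<longleftrightarrow>
     holomorphic3_on Z (- polar_set) \<and>
     (\<forall>p. \<exists>U g. open U \<and> p \<in> U \<and> holomorphic3_on g U \<and>
        (\<forall>s \<in> U - polar_set. (\<Prod>l \<in> {l \<in> polar_forms. l p = 0}. l s) * Z s = g s))"

text \<open>Such a \<open>Z\<close> is unique off the polar set, whose complement is connected.\<close>

definition is_symmetric_zeta :: "(complex3 \<Rightarrow> complex) \<Rightarrow> bool" where
  "is_symmetric_zeta Z \<longleftrightarrow>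
     simple_polar_meromorphic Z \<and>
     (\<forall>s1 s2 s3. Re s1 > 1 \<and> Re s2 > 1 \<and> Re s3 > 1 \<longrightarrow>
        Z (s1, s2, s3) = symmetric_zeta_series (s1, s2, s3))"

end

theory Submission
  imports Defs
begin

text \<open>
  Near \<open>(1, 1, 1)\<close> the only polar hyperplane is \<open>s1 + s2 + s3 = 3\<close>, so
  \<open>(s1 + s2 + s3 - 3) * \<zeta>\<close> agrees off it with a function \<open>g\<close> that is
  continuous at \<open>(1, 1, 1)\<close> (lemma \<open>is_symmetric_zeta_local_form\<close>). The limit is therefore
  \<open>g (1, 1, 1)\<close>, and it suffices to approach the point inside the region of convergence. This is
  done along the real points \<open>(1 + \<delta>, 1 + \<delta>, 1 + t)\<close>, with \<open>\<delta> \<rightarrow> 0\<close> first and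
  \<open>t \<rightarrow> 0\<close> afterwards. All summands are then positive, and the first limit removes
  \<open>\<delta>\<close> from the two exponents by monotonicity; what remains is

  \<open>t * (\<Sum>n1 n2 n3. 1 / ((n1 + n2) * (n2 + n3) * (n3 + n1) powr (1 + t)))\<close>.

  Group the triples by \<open>m = n3 + n1\<close> and write \<open>b = n2\<close>. Partial fractions turn the sum over
  \<open>n1\<close> into \<open>2 / (2 * b + m)\<close> times the harmonic segment
  \<open>1 / (b + 1) + \<dots> + 1 / (b + m - 1)\<close>, which is about
  \<open>\<phi> b = 2 / (2 * b + m) * ln ((b + m) / b)\<close>. The function
  \<open>y \<mapsto> 2 * \<chi> (m / (2 * y + m))\<close>, where
  \<open>\<chi> w = w + w^3 / 9 + w^5 / 25 + \<dots>\<close> is Legendre's chi function, is convex with derivative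
  \<open>- \<phi>\<close>. Its tangent inequality (\<open>slice_potential_tangent\<close>) lets the sum over \<open>b\<close>
  be compared with a telescoping one: the total is at most \<open>2 * \<chi> 1 = pi^2 / 4\<close> for every
  \<open>m\<close> (\<open>sum_slice_upper\<close>) and tends to this value as \<open>m \<rightarrow> \<infinity>\<close>
  (\<open>sum_slice_lower\<close>). Since \<open>t * (\<Sum>m\<ge>M. m powr - (1 + t))\<close> tends to 1 as
  \<open>t \<rightarrow> 0\<close>, whatever the starting index \<open>M\<close>, the whole expression tends to
  \<open>pi^2 / 4\<close>. The triple series enters only through its finite subsums.
\<close>

section \<open>Tangent inequalities for powers and the logarithm\<close>

text \<open>Convexity of \<open>p \<mapsto> (x / y) powr p\<close> at \<open>p = 0\<close>. It holds for either order of
  \<open>x\<close> and \<open>y\<close> and either sign of \<open>p\<close>, so exchanging \<open>x\<close> and \<open>y\<close> gives the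
  matching upper bound. It serves both the terms of Legendre's chi function (\<open>p\<close> odd) and the
  sums of \<open>m powr - (1 + t)\<close> (\<open>p = - t\<close>).\<close>

lemma powr_tangent:
  fixes x y p :: real
  assumes "0 < x" "0 < y"
  shows "p * y powr p * ln (x / y) \<le> x powr p - y powr p"
proof -
  have "x powr p = y powr p * exp (p * ln (x / y))"
    using assms by (simp add: powr_def ln_div right_diff_distrib flip: exp_add)
  moreover have "1 + p * ln (x / y) \<le> exp (p * ln (x / y))"
    by (rule exp_ge_add_one_self)
  then have "y powr p * (1 + p * ln (x / y)) \<le> y powr p * exp (p * ln (x / y))"
    by (intro mult_left_mono) auto
  ultimately show ?thesis
    by (simp add: algebra_simps)
qed

lemma one_minus_inverse_le_ln:
  fixes x y :: real
  assumes "0 < x" "0 < y"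
  shows "(x - y) / x \<le> ln (x / y)"
proof -
  have "ln (y / x) \<le> y / x - 1"
    using assms by (intro ln_le_minus_one) auto
  with assms show ?thesis
    by (simp add: ln_div diff_divide_distrib)
qed

section \<open>Legendre's chi function\<close>

definition legendre_chi :: "real \<Rightarrow> real" where
  "legendre_chi w = (\<Sum>k. w ^ (2 * k + 1) / (2 * real k + 1)\<^sup>2)"

text \<open>Remove the even terms, a quarter of the whole, from the series of inverse squares.\<close>

lemma odd_squares_sums: "(\<lambda>k. 1 / (2 * real k + 1)\<^sup>2) sums (pi\<^sup>2 / 8)"
proof -
  define f where "f = (\<lambda>n::nat. 1 / (real n + 1)\<^sup>2)"
  have f: "f sums (pi\<^sup>2 / 6)"
    unfolding f_def using inverse_squares_sums by (simp add: add.commute)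
  have "(\<lambda>n. \<Sum>i\<in>{n * 2..<n * 2 + 2}. f i) sums (pi\<^sup>2 / 6)"
    by (rule sums_group[OF f]) simp
  moreover have "(\<Sum>i\<in>{n * 2..<n * 2 + 2}. f i) = f (2 * n) + f n / 4" for n
  proof -
    have "{n * 2..<n * 2 + 2} = {2 * n, 2 * n + 1}" by auto
    moreover have "f (2 * n + 1) = f n / 4"
      by (simp add: f_def field_simps power2_eq_square)
    ultimately show ?thesis by simp
  qed
  ultimately have "(\<lambda>n. f (2 * n) + f n / 4) sums (pi\<^sup>2 / 6)" by simp
  from sums_diff[OF this sums_divide[OF f, of 4]]
  have "(\<lambda>n. f (2 * n)) sums (pi\<^sup>2 / 6 - pi\<^sup>2 / 6 / 4)" by simp
  moreover have "pi\<^sup>2 / 6 - pi\<^sup>2 / 6 / 4 = pi\<^sup>2 / 8" by simp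
  ultimately show ?thesis by (simp add: f_def)
qed

lemma legendre_chi_1: "legendre_chi 1 = pi\<^sup>2 / 8"
  using sums_unique[OF odd_squares_sums] by (simp add: legendre_chi_def)

lemma legendre_chi_summable:
  assumes "0 \<le> w" "w \<le> 1"
  shows "summable (\<lambda>k. w ^ (2 * k + 1) / (2 * real k + 1)\<^sup>2)"
proof (rule summable_comparison_test'[OF sums_summable[OF odd_squares_sums]])
  fix k :: nat
  show "norm (w ^ (2 * k + 1) / (2 * real k + 1)\<^sup>2) \<le> 1 / (2 * real k + 1)\<^sup>2"
    using assms power_le_one[of w "2 * k + 1"] by (auto simp: divide_simps)
qed

lemma continuous_on_legendre_chi: "continuous_on {0..1} legendre_chi"
proof -
  have "uniform_limit {0..1} (\<lambda>n w. \<Sum>k<n. w ^ (2 * k + 1) / (2 * real k + 1)\<^sup>2)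
          (\<lambda>w. \<Sum>k. w ^ (2 * k + 1) / (2 * real k + 1)\<^sup>2) sequentially"
  proof (rule Weierstrass_m_test[OF _ sums_summable[OF odd_squares_sums]])
    fix k :: nat and w :: real
    assume "w \<in> {0..1}"
    then show "norm (w ^ (2 * k + 1) / (2 * real k + 1)\<^sup>2) \<le> 1 / (2 * real k + 1)\<^sup>2"
      using power_le_one[of w "2 * k + 1"] by (auto simp: divide_simps)
  qed
  then have "continuous_on {0..1} (\<lambda>w. \<Sum>k. w ^ (2 * k + 1) / (2 * real k + 1)\<^sup>2)"
    by (rule uniform_limit_theorem[rotated])
       (auto intro!: always_eventually continuous_intros)
  then show ?thesis by (simp add: legendre_chi_def[abs_def])
qed

text \<open>As a function of \<open>ln w\<close>, Legendre's chi function has the derivative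
  \<open>w + w^3 / 3 + w^5 / 5 + \<dots> = ln ((1 + w) / (1 - w)) / 2\<close>, and it is convex because each of its
  terms is. Working term by term includes the end point \<open>v = 1\<close>.\<close>

lemma legendre_chi_tangent:
  assumes "0 < v" "v \<le> 1" "0 < w" "w < 1"
  shows "ln (v / w) * ln ((1 + w) / (1 - w)) \<le> 2 * legendre_chi v - 2 * legendre_chi w"
proof -
  define x where "x = (1 + w) / (1 - w)"
  have x: "0 < x" "(x - 1) / (x + 1) = w"
    using assms by (auto simp: x_def field_simps)
  have "(\<lambda>n. 2 * ((x - 1) / (x + 1)) ^ (2 * n + 1) / of_nat (2 * n + 1)) sums ln x"
    using ln_series_quadratic[OF x(1)] by simp
  then have A: "(\<lambda>n. ln (v / w) * (2 * w ^ (2 * n + 1) / real (2 * n + 1))) sums (ln (v / w) * ln x)"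
    unfolding x(2) by (rule sums_mult)
  have "(\<lambda>k. v ^ (2 * k + 1) / (2 * real k + 1)\<^sup>2) sums legendre_chi v"
       "(\<lambda>k. w ^ (2 * k + 1) / (2 * real k + 1)\<^sup>2) sums legendre_chi w"
    unfolding legendre_chi_def using assms
    by (intro summable_sums legendre_chi_summable; simp)+
  then have B: "(\<lambda>k. 2 * (v ^ (2 * k + 1) / (2 * real k + 1)\<^sup>2) - 2 * (w ^ (2 * k + 1) / (2 * real k + 1)\<^sup>2))
      sums (2 * legendre_chi v - 2 * legendre_chi w)"
    by (intro sums_diff sums_mult)
  show ?thesis unfolding x_def[symmetric]
  proof (rule sums_le[OF _ A B])
    fix n :: nat
    define p where "p = 2 * n + 1"
    have "real p * w ^ p * ln (v / w) \<le> v ^ p - w ^ p"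
      using powr_tangent[of v w "real p"] assms by (simp add: powr_realpow)
    moreover have "0 < real p" by (simp add: p_def)
    ultimately have "2 * (real p * w ^ p * ln (v / w)) / (real p)\<^sup>2 \<le> 2 * (v ^ p - w ^ p) / (real p)\<^sup>2"
      by (intro divide_right_mono) auto
    then have "ln (v / w) * (2 * w ^ p / real p) \<le> 2 * (v ^ p / (real p)\<^sup>2) - 2 * (w ^ p / (real p)\<^sup>2)"
      using \<open>0 < real p\<close> by (simp add: field_simps power2_eq_square)
    moreover have "2 * real n + 1 = real p" by (simp add: p_def)
    ultimately show "ln (v / w) * (2 * w ^ (2 * n + 1) / real (2 * n + 1))
        \<le> 2 * (v ^ (2 * n + 1) / (2 * real n + 1)\<^sup>2) - 2 * (w ^ (2 * n + 1) / (2 * real n + 1)\<^sup>2)"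
      unfolding p_def[symmetric] by simp
  qed
qed

section \<open>The convex primitive used for telescoping\<close>

definition slice_potential :: "real \<Rightarrow> real \<Rightarrow> real" where
  "slice_potential m y = 2 * legendre_chi (m / (2 * y + m))"

text \<open>The substitution \<open>w = m / (2 * y + m)\<close> turns \<open>(1 + w) / (1 - w)\<close> into
  \<open>(y + m) / y\<close>. The steps \<open>z = y - 1\<close> and \<open>z = y + 1\<close> bound the function
  \<open>2 / (2 * y + m) * ln ((y + m) / y)\<close> from above and from below by differences.\<close>

lemma slice_potential_tangent:
  assumes "0 < m" "0 < y" "0 \<le> z"
  shows "2 * (y - z) / (2 * y + m) * ln ((y + m) / y) \<le> slice_potential m z - slice_potential m y"
proof -
  define v w where "v = m / (2 * z + m)" and "w = m / (2 * y + m)"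
  have vw: "0 < v" "v \<le> 1" "0 < w" "w < 1" "(1 + w) / (1 - w) = (y + m) / y"
       "v / w = (2 * y + m) / (2 * z + m)"
    using assms by (auto simp: v_def w_def divide_simps)
  have "2 * (y - z) / (2 * y + m) \<le> ln (v / w)"
    using one_minus_inverse_le_ln[of "2 * y + m" "2 * z + m"] assms
    by (simp add: vw(6) algebra_simps)
  moreover have "0 \<le> ln ((y + m) / y)"
    using assms by simp
  ultimately have "2 * (y - z) / (2 * y + m) * ln ((y + m) / y) \<le> ln (v / w) * ln ((y + m) / y)"
    by (rule mult_right_mono)
  also have "\<dots> \<le> slice_potential m z - slice_potential m y"
    using legendre_chi_tangent[OF vw(1-4)] vw(5)
    by (simp add: slice_potential_def v_def w_def)
  finally show ?thesis .
qed

lemma slice_potential_0: "0 < m \<Longrightarrow> slice_potential m 0 = pi\<^sup>2 / 4"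
  by (simp add: slice_potential_def legendre_chi_1)

lemma slice_potential_nonneg:
  assumes "0 < m" "0 \<le> y"
  shows "0 \<le> slice_potential m y"
  using assms unfolding slice_potential_def legendre_chi_def
  by (intro mult_nonneg_nonneg suminf_nonneg legendre_chi_summable) auto

lemma slice_potential_at_top:
  assumes "0 < m"
  shows "(\<lambda>B. slice_potential m (real B + c)) \<longlonglongrightarrow> 0"
proof -
  have "filterlim (\<lambda>B. (2 * c + m) + 2 * real B) at_top sequentially"
    by (intro filterlim_tendsto_add_at_top[OF tendsto_const]
          filterlim_tendsto_pos_mult_at_top[OF tendsto_const] filterlim_real_sequentially) simp
  from real_tendsto_divide_at_top[OF tendsto_const this, of m]
  have lim: "(\<lambda>B. m / (2 * (real B + c) + m)) \<longlonglongrightarrow> 0"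
    by (simp add: algebra_simps)
  have "eventually (\<lambda>B. m / (2 * (real B + c) + m) \<in> {0..1}) sequentially"
  proof -
    have "eventually (\<lambda>B. real B \<ge> -c) sequentially"
      using filterlim_real_sequentially by (simp add: filterlim_at_top)
    then show ?thesis
      by eventually_elim (use assms in auto)
  qed
  then have "(\<lambda>B. legendre_chi (m / (2 * (real B + c) + m))) \<longlonglongrightarrow> legendre_chi 0"
    by (intro continuous_on_tendsto_compose[OF continuous_on_legendre_chi lim]) auto
  moreover have "legendre_chi 0 = 0" by (simp add: legendre_chi_def)
  ultimately show ?thesis
    unfolding slice_potential_def by (auto intro!: tendsto_eq_intros)
qed

lemma slice_potential_tendsto:
  assumes "0 \<le> c"
  shows "(\<lambda>m. slice_potential (real m) c) \<longlonglongrightarrow> pi\<^sup>2 / 4"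
proof -
  have "(\<lambda>m. 2 * c / real m) \<longlonglongrightarrow> 0"
    by (rule real_tendsto_divide_at_top[OF tendsto_const filterlim_real_sequentially])
  then have "(\<lambda>m. 1 / (2 * c / real m + 1)) \<longlonglongrightarrow> 1"
    by (auto intro!: tendsto_eq_intros)
  moreover have "eventually (\<lambda>m. 1 / (2 * c / real m + 1) = real m / (2 * c + real m)) sequentially"
    using eventually_gt_at_top[of 0] by eventually_elim (use assms in \<open>auto simp: field_simps\<close>)
  ultimately have "(\<lambda>m. real m / (2 * c + real m)) \<longlonglongrightarrow> 1"
    by (rule Lim_transform_eventually)
  then have "(\<lambda>m. legendre_chi (real m / (2 * c + real m))) \<longlonglongrightarrow> legendre_chi 1"
    using assms
    by (intro continuous_on_tendsto_compose[OF continuous_on_legendre_chi])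
       (auto simp: divide_simps intro!: always_eventually)
  then have "(\<lambda>m. slice_potential (real m) c) \<longlonglongrightarrow> 2 * legendre_chi 1"
    unfolding slice_potential_def by (intro tendsto_mult tendsto_const)
  then show ?thesis by (simp add: legendre_chi_1)
qed

section \<open>Triples with a prescribed value of the third pair sum\<close>

lemma harmonic_segment_bounds:
  assumes "1 \<le> b"
  shows "(\<Sum>a=1..k. 1 / real (a + b)) \<le> ln (real b + real k) - ln (real b)"
    and "ln (real b + real k + 1) - ln (real b + 1) \<le> (\<Sum>a=1..k. 1 / real (a + b))"
proof (induction k)
  case (Suc k)
  define x where "x = real b + real k + 1"
  have x: "1 < x" using assms by (simp add: x_def)
  have "1 / x \<le> ln x - ln (x - 1)"
    using one_minus_inverse_le_ln[of x "x - 1"] x by (simp add: ln_div)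
  moreover have "ln (x + 1) - ln x \<le> 1 / x"
    using one_minus_inverse_le_ln[of x "x + 1"] x by (simp add: ln_div)
  ultimately show
    "(\<Sum>a=1..Suc k. 1 / real (a + b)) \<le> ln (real b + real (Suc k)) - ln (real b)"
    "ln (real b + real (Suc k) + 1) - ln (real b + 1) \<le> (\<Sum>a=1..Suc k. 1 / real (a + b))"
    using Suc.IH by (simp_all add: x_def algebra_simps)
qed simp_all

text \<open>The summand at \<open>\<delta> = 0\<close> without its third factor, summed over the triples
  \<open>(a, b, c)\<close> with \<open>a + c = m\<close>.\<close>

definition slice :: "nat \<Rightarrow> nat \<Rightarrow> real" where
  "slice m b = (\<Sum>a=1..<m. 1 / (real (a + b) * real (b + (m - a))))"

text \<open>Partial fractions: with \<open>c = m - a\<close> the two factors \<open>a + b\<close> and \<open>b + c\<close> have the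
  constant sum \<open>2 * b + m\<close>, and the reflection \<open>a \<mapsto> m - a\<close> exchanges them.\<close>

lemma slice_eq_harmonic:
  assumes "1 \<le> b"
  shows "slice m b = 2 / (2 * real b + real m) * (\<Sum>a=1..<m. 1 / real (a + b))"
proof -
  have "slice m b = (\<Sum>a=1..<m. (1 / real (a + b) + 1 / real ((m - a) + b)) / (2 * real b + real m))"
    unfolding slice_def
  proof (rule sum.cong[OF refl])
    fix a assume a: "a \<in> {1..<m}"
    define x y where "x = real (a + b)" and "y = real (b + (m - a))"
    have "0 < x" "0 < y" "2 * real b + real m = x + y"
      using a assms by (auto simp: x_def y_def)
    moreover from this have "1 / x + 1 / y = (x + y) / (x * y)"
      by (simp add: field_simps)
    ultimately have "1 / (x * y) = (1 / x + 1 / y) / (2 * real b + real m)"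
      by simp
    then show "1 / (real (a + b) * real (b + (m - a)))
        = (1 / real (a + b) + 1 / real ((m - a) + b)) / (2 * real b + real m)"
      by (simp add: x_def y_def add.commute)
  qed
  also have "\<dots> = ((\<Sum>a=1..<m. 1 / real (a + b)) + (\<Sum>a=1..<m. 1 / real ((m - a) + b)))
      / (2 * real b + real m)"
    by (simp only: sum.distrib flip: sum_divide_distrib)
  also have "(\<Sum>a=1..<m. 1 / real ((m - a) + b)) = (\<Sum>a=1..<m. 1 / real (a + b))"
    by (rule sum.reindex_bij_witness[of _ "\<lambda>a. m - a" "\<lambda>a. m - a"]) auto
  finally show ?thesis by simp
qed

lemma slice_upper:
  assumes "2 \<le> m" "1 \<le> b"
  shows "slice m b \<le> slice_potential m (real b - 1) - slice_potential m (real b)"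
proof -
  obtain k where k: "m = Suc k" using assms by (cases m) auto
  have "(\<Sum>a=1..<m. 1 / real (a + b)) \<le> ln (real b + real k) - ln (real b)"
    using harmonic_segment_bounds(1)[OF assms(2), of k] by (simp add: k atLeastLessThanSuc_atLeastAtMost)
  also have "\<dots> \<le> ln ((real b + real m) / real b)"
    using assms by (simp add: k ln_div)
  finally have "slice m b \<le> 2 / (2 * real b + real m) * ln ((real b + real m) / real b)"
    unfolding slice_eq_harmonic[OF assms(2)] by (rule mult_left_mono) simp
  also have "\<dots> \<le> slice_potential m (real b - 1) - slice_potential m (real b)"
    using slice_potential_tangent[of "real m" "real b" "real b - 1"] assms by simp
  finally show ?thesis .
qed

text \<open>The harmonic segment is one term short of the comparison with \<open>ln ((b + 1 + m) / (b + 1))\<close>.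
  That term costs at most \<open>2 / (m + b)^2\<close>, which is replaced by the telescoping
  \<open>2 / (m + b - 1) - 2 / (m + b)\<close>.\<close>

lemma slice_lower:
  assumes "2 \<le> m" "1 \<le> b"
  shows "(slice_potential m (real b + 1) - slice_potential m (real b + 2))
      - (2 / (real m + real b - 1) - 2 / (real m + real b)) \<le> slice m b"
proof -
  obtain k where k: "m = Suc k" using assms by (cases m) auto
  define l where "l = ln ((real b + 1 + real m) / (real b + 1))"
  have l: "0 \<le> l" by (simp add: l_def)
  have "l - 1 / (real m + real b) \<le> (\<Sum>a=1..<m. 1 / real (a + b))"
  proof -
    define x where "x = real m + real b"
    have x: "0 < x" using assms by (simp add: x_def)
    have "ln (x + 1) - ln x \<le> 1 / x"
      using one_minus_inverse_le_ln[of x "x + 1"] x by (simp add: ln_div)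
    moreover have "l = ln (x + 1) - ln (real b + 1)"
      by (simp add: l_def x_def ln_div add_ac)
    moreover have "ln x - ln (real b + 1) \<le> (\<Sum>a=1..<m. 1 / real (a + b))"
      using harmonic_segment_bounds(2)[OF assms(2), of k]
      by (simp add: k x_def atLeastLessThanSuc_atLeastAtMost add_ac)
    ultimately show ?thesis by (simp add: x_def)
  qed
  then have "2 / (2 * real b + real m) * (l - 1 / (real m + real b)) \<le> slice m b"
    unfolding slice_eq_harmonic[OF assms(2)] by (rule mult_left_mono) simp
  moreover have "slice_potential m (real b + 1) - slice_potential m (real b + 2)
      \<le> 2 / (2 * (real b + 1) + real m) * l"
    using slice_potential_tangent[of "real m" "real b + 1" "real b + 2"] assms
    by (simp add: l_def add_ac)
  moreover have "2 / (2 * (real b + 1) + real m) * l \<le> 2 / (2 * real b + real m) * l"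
    using assms l by (intro mult_right_mono divide_left_mono) auto
  moreover have "2 / (2 * real b + real m) * (1 / (real m + real b))
      \<le> 2 / (real m + real b - 1) - 2 / (real m + real b)"
  proof -
    define x where "x = real m + real b"
    have x: "1 < x" "x \<le> 2 * real b + real m" using assms by (auto simp: x_def)
    have "2 / (2 * real b + real m) * (1 / x) \<le> 2 / (x - 1) * (1 / x)"
      using x by (intro mult_right_mono divide_left_mono) auto
    also have "\<dots> = 2 / (x - 1) - 2 / x"
      using x by (simp add: field_simps)
    finally show ?thesis by (simp add: x_def)
  qed
  ultimately show ?thesis by (simp add: right_diff_distrib)
qed

lemma sum_slice_upper:
  assumes "2 \<le> m"
  shows "(\<Sum>b=1..B. slice m b) \<le> pi\<^sup>2 / 4"
proof -
  have "(\<Sum>b=1..B. slice m b) \<le> slice_potential m 0 - slice_potential m (real B)"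
  proof (induction B)
    case (Suc B)
    then show ?case using slice_upper[OF assms, of "Suc B"] by simp
  qed simp
  then show ?thesis
    using slice_potential_0[of "real m"] slice_potential_nonneg[of "real m" "real B"] assms by simp
qed

lemma sum_slice_lower:
  assumes "2 \<le> m"
  shows "slice_potential m 2 - slice_potential m (real B + 2) - 2 / real m \<le> (\<Sum>b=1..B. slice m b)"
proof -
  have "slice_potential m 2 - slice_potential m (real B + 2) - (2 / real m - 2 / (real m + real B))
      \<le> (\<Sum>b=1..B. slice m b)"
  proof (induction B)
    case (Suc B)
    then show ?case using slice_lower[OF assms, of "Suc B"] by (simp add: add_ac)
  qed simp
  moreover have "0 \<le> 2 / (real m + real B)" by simp
  ultimately show ?thesis by linarith
qed

section \<open>Sums over the third pair sum\<close>

text \<open>Both bounds telescope: \<open>t * m powr - (1 + t)\<close> lies between the decrease of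
  \<open>x powr - t\<close> over \<open>[m, m + 1]\<close> and that over \<open>[m - 1, m]\<close>.\<close>

lemma zeta_tail_upper:
  assumes "0 < t"
  shows "t * (\<Sum>m=2..P. real m powr - (1 + t)) \<le> 1"
proof -
  have "t * (\<Sum>m=2..Suc P. real m powr - (1 + t)) \<le> 1 - real (Suc P) powr - t"
  proof (induction P)
    case (Suc P)
    define x where "x = real (Suc (Suc P))"
    have x: "1 < x" by (simp add: x_def)
    have "t * (x powr - t * (1 / x)) \<le> t * (x powr - t * ln (x / (x - 1)))"
      using assms x one_minus_inverse_le_ln[of x "x - 1"] by (intro mult_left_mono) auto
    also have "\<dots> = - (- t * x powr - t * ln (x / (x - 1)))" by simp
    also have "\<dots> = - t * x powr - t * ln ((x - 1) / x)"
      using x by (simp add: ln_div algebra_simps)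
    also have "\<dots> \<le> (x - 1) powr - t - x powr - t"
      using powr_tangent[of "x - 1" x "- t"] x by simp
    finally have "t * x powr - (1 + t) \<le> (x - 1) powr - t - x powr - t"
      using x by (simp add: powr_diff powr_minus powr_add field_simps)
    then show ?case using Suc.IH by (simp add: x_def distrib_left)
  qed simp
  moreover have "t * (\<Sum>m=2..P. real m powr - (1 + t)) \<le> t * (\<Sum>m=2..Suc P. real m powr - (1 + t))"
    using assms by (intro mult_left_mono sum_mono2) auto
  moreover have "0 \<le> real (Suc P) powr - t" by simp
  ultimately show ?thesis by linarith
qed

lemma zeta_tail_lower:
  assumes "0 < t" "1 \<le> M" "M \<le> P"
  shows "real M powr - t - (real P + 1) powr - t \<le> t * (\<Sum>m=M..P. real m powr - (1 + t))"
proof -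
  have incr: "x powr - t - (x + 1) powr - t \<le> t * x powr - (1 + t)" if "1 \<le> x" for x
  proof -
    have "ln ((x + 1) / x) \<le> 1 / x"
      using one_minus_inverse_le_ln[of x "x + 1"] that by (simp add: ln_div)
    then have "t * x powr - t * ln ((x + 1) / x) \<le> t * x powr - t * (1 / x)"
      using assms by (intro mult_left_mono) auto
    moreover have "x powr - t - (x + 1) powr - t \<le> t * x powr - t * ln ((x + 1) / x)"
      using powr_tangent[of "x + 1" x "- t"] that by simp
    moreover have "x powr - (1 + t) = x powr - t * (1 / x)"
      using that by (simp add: powr_diff powr_minus powr_add field_simps)
    ultimately show ?thesis by simp
  qed
  show ?thesis using assms(3)
  proof (induction P rule: dec_induct)
    case base
    then show ?case using incr[of "real M"] assms by simp
  next
    case (step P)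
    then show ?case using incr[of "real P + 1"] assms
      by (simp add: distrib_left add_ac)
  qed
qed

section \<open>The triple series at real points\<close>

definition summand :: "real \<Rightarrow> real \<Rightarrow> nat \<times> nat \<times> nat \<Rightarrow> real" where
  "summand \<delta> t = (\<lambda>(n1, n2, n3). 1 / (real (n1 + n2) powr (1 + \<delta>) *
     real (n2 + n3) powr (1 + \<delta>) * real (n3 + n1) powr (1 + t)))"

abbreviation positive_triples :: "(nat \<times> nat \<times> nat) set" where
  "positive_triples \<equiv> {1..} \<times> {1..} \<times> {1..}"

text \<open>The positive triples with \<open>n3 + n1\<close> between \<open>M\<close> and \<open>P\<close> and with
  \<open>n2\<close> at most \<open>B\<close>, parametrized by \<open>(n3 + n1, n2, n1)\<close> so that sums over them factor
  into slices.\<close>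

definition slab :: "nat \<Rightarrow> nat \<Rightarrow> nat \<Rightarrow> (nat \<times> nat \<times> nat) set" where
  "slab M P B = (\<lambda>(m, b, a). (a, b, m - a)) ` (SIGMA m:{M..P}. {1..B} \<times> {1..<m})"

lemma slab_subset: "finite (slab M P B)" "slab M P B \<subseteq> positive_triples"
  by (auto simp: slab_def)

lemma sum_slab:
  "(\<Sum>n\<in>slab M P B. summand 0 t n) = (\<Sum>m=M..P. real m powr - (1 + t) * (\<Sum>b=1..B. slice m b))"
proof -
  let ?D = "SIGMA m:{M..P}. {1..B} \<times> {1..<m}"
  have "inj_on (\<lambda>(m, b, a). (a, b, m - a)) ?D"
    by (auto simp: inj_on_def)
  then have "(\<Sum>n\<in>slab M P B. summand 0 t n) = (\<Sum>(m, b, a)\<in>?D. summand 0 t (a, b, m - a))"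
    unfolding slab_def by (subst sum.reindex) (auto simp: case_prod_beta intro!: sum.cong)
  also have "\<dots> = (\<Sum>m=M..P. \<Sum>(b, a)\<in>{1..B} \<times> {1..<m}. summand 0 t (a, b, m - a))"
    by (subst sum.Sigma) auto
  also have "\<dots> = (\<Sum>m=M..P. \<Sum>b=1..B. \<Sum>a=1..<m. summand 0 t (a, b, m - a))"
    by (simp add: sum.cartesian_product)
  also have "\<dots> = (\<Sum>m=M..P. real m powr - (1 + t) * (\<Sum>b=1..B. slice m b))"
    unfolding slice_def sum_distrib_left powr_minus_divide
    by (intro sum.cong refl) (auto simp: summand_def)
  finally show ?thesis .
qed

lemma summand_nonneg: "0 \<le> summand \<delta> t n"
  by (auto simp: summand_def case_prod_beta)

lemma summand_antimono:
  assumes "0 \<le> \<delta>" "n \<in> positive_triples"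
  shows "summand \<delta> t n \<le> summand 0 t n"
proof -
  obtain n1 n2 n3 where n: "n = (n1, n2, n3)" "1 \<le> n1" "1 \<le> n2" "1 \<le> n3"
    using assms by (cases n) auto
  have "real (n1 + n2) powr (1 + 0) \<le> real (n1 + n2) powr (1 + \<delta>)"
       "real (n2 + n3) powr (1 + 0) \<le> real (n2 + n3) powr (1 + \<delta>)"
    using n assms by (intro powr_mono; simp)+
  then show ?thesis
    unfolding summand_def n(1) prod.case using n
    by (intro divide_left_mono mult_mono mult_pos_pos) (auto simp del: powr_one)
qed

lemma sum_summand_upper:
  assumes "0 < t" "finite A" "A \<subseteq> positive_triples"
  shows "t * (\<Sum>n\<in>A. summand 0 t n) \<le> pi\<^sup>2 / 4"
proof -
  \<comment> \<open>A crude bound for all coordinates and pair sums that occur in \<open>A\<close>.\<close>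
  define N where "N = (\<Sum>(n1, n2, n3)\<in>A. n1 + n2 + n3)"
  have "A \<subseteq> slab 2 N N"
  proof
    fix n assume n: "n \<in> A"
    obtain n1 n2 n3 where e: "n = (n1, n2, n3)" by (cases n)
    have pos: "1 \<le> n1" "1 \<le> n2" "1 \<le> n3" using n e assms(3) by auto
    have "(case n of (n1, n2, n3) \<Rightarrow> n1 + n2 + n3) \<le> N"
      unfolding N_def using member_le_sum[OF n _ assms(2), of "\<lambda>(n1, n2, n3). n1 + n2 + n3"] by auto
    then have "n1 + n2 + n3 \<le> N" by (simp add: e)
    with pos have "(n1 + n3, n2, n1) \<in> (SIGMA m:{2..N}. {1..N} \<times> {1..<m})"
      by auto
    then have "(\<lambda>(m, b, a). (a, b, m - a)) (n1 + n3, n2, n1) \<in> slab 2 N N"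
      unfolding slab_def by (rule imageI)
    then show "n \<in> slab 2 N N" by (simp add: e)
  qed
  then have "(\<Sum>n\<in>A. summand 0 t n) \<le> (\<Sum>n\<in>slab 2 N N. summand 0 t n)"
    by (intro sum_mono2 slab_subset summand_nonneg)
  also have "\<dots> = (\<Sum>m=2..N. real m powr - (1 + t) * (\<Sum>b=1..N. slice m b))"
    by (rule sum_slab)
  also have "\<dots> \<le> (\<Sum>m=2..N. real m powr - (1 + t) * (pi\<^sup>2 / 4))"
    by (intro sum_mono mult_left_mono sum_slice_upper) auto
  also have "\<dots> = (\<Sum>m=2..N. real m powr - (1 + t)) * (pi\<^sup>2 / 4)"
    by (rule sum_distrib_right[symmetric])
  finally have "t * (\<Sum>n\<in>A. summand 0 t n)
      \<le> t * ((\<Sum>m=2..N. real m powr - (1 + t)) * (pi\<^sup>2 / 4))"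
    using assms(1) by (intro mult_left_mono) auto
  also have "\<dots> = (t * (\<Sum>m=2..N. real m powr - (1 + t))) * (pi\<^sup>2 / 4)"
    by (simp add: mult.assoc)
  also have "\<dots> \<le> 1 * (pi\<^sup>2 / 4)"
    by (intro mult_right_mono zeta_tail_upper assms(1)) simp
  finally show ?thesis by simp
qed

text \<open>The constant \<open>M\<close> does not depend on \<open>t\<close>: for every \<open>m \<ge> M\<close> the slices have a
  total above \<open>c\<close>, and the factor \<open>M powr - t\<close> is what the omission of the smaller
  \<open>m\<close> costs. It tends to 1 with \<open>t \<rightarrow> 0\<close>, so \<open>c\<close> survives in the limit. The bound is
  phrased for an upper bound \<open>C\<close> of the finite subsums because \<open>C\<close> will be the value of a
  continuous function at a boundary point of the region \<open>Re s1, Re s2, Re s3 > 1\<close>.\<close>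

lemma sum_summand_lower:
  assumes "c < pi\<^sup>2 / 4" "0 \<le> c"
  shows "\<exists>M::nat. 1 \<le> M \<and> (\<forall>t C. 0 < t \<longrightarrow>
    (\<forall>A. finite A \<longrightarrow> A \<subseteq> positive_triples \<longrightarrow> t * (\<Sum>n\<in>A. summand 0 t n) \<le> C) \<longrightarrow>
    c * real M powr - t \<le> C)"
proof -
  have "(\<lambda>m. slice_potential (real m) 2 - 2 / real m) \<longlonglongrightarrow> pi\<^sup>2 / 4 - 0"
    by (intro tendsto_diff slice_potential_tendsto
          real_tendsto_divide_at_top[OF tendsto_const filterlim_real_sequentially]) simp
  then have "eventually (\<lambda>m. c < slice_potential (real m) 2 - 2 / real m) sequentially"
    using assms by (intro order_tendstoD(1)) auto
  then obtain M0 where M0: "\<And>m. M0 \<le> m \<Longrightarrow> c < slice_potential (real m) 2 - 2 / real m"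
    by (auto simp: eventually_sequentially)
  define M where "M = max M0 2"
  show ?thesis
  proof (intro exI conjI allI impI)
    show "1 \<le> M" by (simp add: M_def)
    fix t C :: real
    assume t: "0 < t"
      and "\<forall>A. finite A \<longrightarrow> A \<subseteq> positive_triples \<longrightarrow> t * (\<Sum>n\<in>A. summand 0 t n) \<le> C"
    then have C: "t * (\<Sum>n\<in>A. summand 0 t n) \<le> C" if "finite A" "A \<subseteq> positive_triples" for A
      using that by blast
    have row: "c * (t * (\<Sum>m=M..P. real m powr - (1 + t))) \<le> C" for P
    proof -
      \<comment> \<open>The slab with \<open>n2\<close> at most \<open>B\<close> gives the bound up to a term that vanishes as
        \<open>B\<close> grows.\<close>
      let ?r = "\<lambda>m B. slice_potential (real m) 2 - slice_potential (real m) (real B + 2) - 2 / real m"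
      let ?r' = "\<lambda>m. slice_potential (real m) 2 - 0 - 2 / real m"
      have "t * (\<Sum>m=M..P. real m powr - (1 + t) * ?r' m) \<le> C"
      proof (rule LIMSEQ_le_const2)
        show "(\<lambda>B. t * (\<Sum>m=M..P. real m powr - (1 + t) * ?r m B))
            \<longlonglongrightarrow> t * (\<Sum>m=M..P. real m powr - (1 + t) * ?r' m)"
          by (intro tendsto_intros slice_potential_at_top) (auto simp: M_def)
        have "t * (\<Sum>m=M..P. real m powr - (1 + t) * ?r m B) \<le> C" for B
        proof -
          have "(\<Sum>m=M..P. real m powr - (1 + t) * ?r m B) \<le> (\<Sum>n\<in>slab M P B. summand 0 t n)"
            unfolding sum_slab
            by (intro sum_mono mult_left_mono sum_slice_lower) (auto simp: M_def)
          then have "t * (\<Sum>m=M..P. real m powr - (1 + t) * ?r m B) \<le> t * (\<Sum>n\<in>slab M P B. summand 0 t n)"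
            using t by (intro mult_left_mono) auto
          also have "\<dots> \<le> C" by (intro C slab_subset)
          finally show ?thesis .
        qed
        then show "\<exists>N. \<forall>B\<ge>N. t * (\<Sum>m=M..P. real m powr - (1 + t) * ?r m B) \<le> C"
          by blast
      qed
      moreover have "(\<Sum>m=M..P. real m powr - (1 + t) * c) \<le> (\<Sum>m=M..P. real m powr - (1 + t) * ?r' m)"
        using M0 by (intro sum_mono mult_left_mono) (auto simp: M_def less_imp_le)
      then have "t * (\<Sum>m=M..P. real m powr - (1 + t) * c)
          \<le> t * (\<Sum>m=M..P. real m powr - (1 + t) * ?r' m)"
        using t by (intro mult_left_mono) auto
      moreover have "t * (\<Sum>m=M..P. real m powr - (1 + t) * c)
          = c * (t * (\<Sum>m=M..P. real m powr - (1 + t)))"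
        unfolding sum_distrib_right[symmetric] by (simp only: mult_ac)
      ultimately show ?thesis by linarith
    qed
    show "c * real M powr - t \<le> C"
    proof (rule LIMSEQ_le_const2)
      have "filterlim (\<lambda>P. 1 + real P) at_top sequentially"
        by (intro filterlim_tendsto_add_at_top[OF tendsto_const] filterlim_real_sequentially)
      then have "(\<lambda>P. (real P + 1) powr - t) \<longlonglongrightarrow> 0"
        using t by (intro tendsto_neg_powr) (auto simp: add.commute)
      then show "(\<lambda>P. c * (real M powr - t - (real P + 1) powr - t)) \<longlonglongrightarrow> c * real M powr - t"
        using tendsto_mult[OF tendsto_const[of c] tendsto_diff[OF tendsto_const[of "real M powr - t"]]]
        by fastforce
      have "c * (real M powr - t - (real P + 1) powr - t) \<le> C" if "M \<le> P" for P
        using mult_left_mono[OF zeta_tail_lower[OF t \<open>1 \<le> M\<close> that] assms(2)] row[of P] by linarith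
      then show "\<exists>N. \<forall>P\<ge>N. c * (real M powr - t - (real P + 1) powr - t) \<le> C"
        by blast
    qed
  qed
qed

definition real_series :: "real \<Rightarrow> real \<Rightarrow> real" where
  "real_series \<delta> t = (\<Sum>\<^sub>\<infinity>n\<in>positive_triples. summand \<delta> t n)"

lemma
  assumes "0 < t" "0 \<le> \<delta>"
  shows summand_summable: "summand \<delta> t summable_on positive_triples"
    and real_series_upper: "t * real_series \<delta> t \<le> pi\<^sup>2 / 4"
proof -
  have bound: "(\<Sum>n\<in>A. summand \<delta> t n) \<le> pi\<^sup>2 / 4 / t" if "finite A" "A \<subseteq> positive_triples" for A
  proof -
    have "(\<Sum>n\<in>A. summand \<delta> t n) \<le> (\<Sum>n\<in>A. summand 0 t n)"
      using that assms by (intro sum_mono summand_antimono) auto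
    also have "\<dots> \<le> pi\<^sup>2 / 4 / t"
      using sum_summand_upper[OF assms(1) that] assms(1) by (simp add: pos_le_divide_eq mult_ac)
    finally show ?thesis .
  qed
  show summable: "summand \<delta> t summable_on positive_triples"
  proof (rule nonneg_bdd_above_summable_on)
    show "bdd_above (sum (summand \<delta> t) ` {A. A \<subseteq> positive_triples \<and> finite A})"
      by (rule bdd_aboveI2[where M = "pi\<^sup>2 / 4 / t"]) (elim CollectE conjE, rule bound)
  qed (rule summand_nonneg)
  have "real_series \<delta> t \<le> pi\<^sup>2 / 4 / t"
    unfolding real_series_def by (rule infsum_le_finite_sums[OF summable bound])
  then show "t * real_series \<delta> t \<le> pi\<^sup>2 / 4"
    using assms(1) by (simp add: pos_le_divide_eq mult_ac)
qed

lemma real_series_ge_finite_sum: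
  assumes "0 < t" "0 \<le> \<delta>" "finite A" "A \<subseteq> positive_triples"
  shows "(\<Sum>n\<in>A. summand \<delta> t n) \<le> real_series \<delta> t"
  unfolding real_series_def
  by (rule finite_sum_le_infsum[OF summand_summable]) (use assms summand_nonneg in auto)

lemma symmetric_zeta_series_real:
  assumes "0 < t" "0 \<le> \<delta>"
  shows "symmetric_zeta_series (1 + of_real \<delta>, 1 + of_real \<delta>, 1 + of_real t) = of_real (real_series \<delta> t)"
proof -
  have "((\<lambda>n. complex_of_real (summand \<delta> t n)) has_sum of_real (real_series \<delta> t)) positive_triples"
    unfolding real_series_def using summand_summable[OF assms]
    by (intro has_sum_of_real has_sum_infsum)
  moreover have "complex_of_real (summand \<delta> t n) = (case n of (n1, n2, n3) \<Rightarrow>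
      1 / (of_nat (n1 + n2) powr (1 + of_real \<delta>) * of_nat (n2 + n3) powr (1 + of_real \<delta>)
        * of_nat (n3 + n1) powr (1 + of_real t)))" for n
  proof -
    have "complex_of_real (real k powr (1 + u)) = of_nat k powr (1 + of_real u)" for k :: nat and u
      using powr_of_real[of "real k" "1 + u"] by simp
    then show ?thesis
      by (simp add: summand_def case_prod_beta del: of_nat_add)
  qed
  ultimately show ?thesis
    unfolding symmetric_zeta_series_def by (simp add: infsumI)
qed

section \<open>The continuation near the point (1, 1, 1)\<close>

lemma polar_forms_at_ones:
  "{l \<in> polar_forms. l (1, 1, 1) = 0} = {\<lambda>(s1, s2, s3). s1 + s2 + s3 - 3}"
proof -
  have two: "(2::complex) - (2 - of_nat k) \<noteq> 0" if "1 \<le> k" for k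
    using that by simp
  have three: "(3::complex) - (4 - of_nat k) = 0 \<longleftrightarrow> k = 1" for k
  proof -
    have "(3::complex) - (4 - of_nat k) = of_nat k - of_nat 1" by simp
    then show ?thesis by (simp only: right_minus_eq of_nat_eq_iff)
  qed
  have "(\<lambda>(s1, s2, s3). s1 + s2 + s3 - 3) = (\<lambda>(s1, s2, s3). s1 + s2 + s3 - (4 - of_nat 1 :: complex))"
    by simp
  with two three show ?thesis
    unfolding polar_forms_def by (auto 0 3)
qed

text \<open>An open neighbourhood of \<open>(1, 1, 1)\<close> met by no polar hyperplane but
  \<open>s1 + s2 + s3 = 3\<close>: the value \<open>2/3\<close> makes the real parts of the pair sums exceed
  \<open>1\<close> and that of the total exceed \<open>2\<close>.\<close>

definition region_near_ones :: "complex3 set" where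
  "region_near_ones = {(s1, s2, s3). 2/3 < Re s1 \<and> 2/3 < Re s2 \<and> 2/3 < Re s3}"

lemma open_region_near_ones: "open region_near_ones"
  unfolding region_near_ones_def case_prod_beta
  by (intro open_Collect_conj open_Collect_less continuous_intros)

lemma polar_set_region_near_ones:
  assumes "(s1, s2, s3) \<in> region_near_ones" "(s1, s2, s3) \<in> polar_set"
  shows "s1 + s2 + s3 = 3"
proof -
  have re: "2/3 < Re s1" "2/3 < Re s2" "2/3 < Re s3"
    using assms(1) by (auto simp: region_near_ones_def)
  obtain k :: nat where k: "1 \<le> k" and
    "s1 + s2 = 2 - of_nat k \<or> s2 + s3 = 2 - of_nat k \<or> s3 + s1 = 2 - of_nat k
      \<or> s1 + s2 + s3 = 4 - of_nat k"
    using assms(2) by (auto simp: polar_set_def polar_forms_def)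
  then have "Re s1 + Re s2 = 2 - real k \<or> Re s2 + Re s3 = 2 - real k \<or> Re s3 + Re s1 = 2 - real k
      \<or> (Re s1 + Re s2 + Re s3 = 4 - real k \<and> s1 + s2 + s3 = 4 - of_nat k)"
    by (auto simp: complex_eq_iff)
  moreover have "1 \<le> real k" using k by simp
  then have "Re s1 + Re s2 \<noteq> 2 - real k" "Re s2 + Re s3 \<noteq> 2 - real k" "Re s3 + Re s1 \<noteq> 2 - real k"
    using re by linarith+
  ultimately have eq: "Re s1 + Re s2 + Re s3 = 4 - real k" "s1 + s2 + s3 = 4 - of_nat k"
    by auto
  have "real k < 2" using eq(1) re by linarith
  with k have "k = 1" by simp
  with eq(2) show ?thesis by simp
qed

lemma holomorphic3_on_isCont:
  assumes "holomorphic3_on f U" "p \<in> U"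
  shows "isCont f p"
  using assms unfolding holomorphic3_on_def by (blast intro: has_derivative_continuous)

lemma is_symmetric_zeta_local_form:
  assumes "is_symmetric_zeta Z"
  obtains U g where "open U" "(1, 1, 1) \<in> U" "\<And>p. p \<in> U \<Longrightarrow> isCont g p"
    "\<And>s1 s2 s3. (s1, s2, s3) \<in> U \<Longrightarrow> s1 + s2 + s3 \<noteq> 3 \<Longrightarrow>
      g (s1, s2, s3) = (s1 + s2 + s3 - 3) * Z (s1, s2, s3)"
proof -
  obtain U g where U: "open U" "(1, 1, 1) \<in> U" "holomorphic3_on g U" and
    g: "\<forall>s \<in> U - polar_set. (\<Prod>l \<in> {l \<in> polar_forms. l (1, 1, 1) = 0}. l s) * Z s = g s"
    using assms unfolding is_symmetric_zeta_def simple_polar_meromorphic_def by meson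
  show ?thesis
  proof (rule that[of "U \<inter> region_near_ones" g])
    show "open (U \<inter> region_near_ones)" using U(1) open_region_near_ones by (rule open_Int)
    show "(1, 1, 1) \<in> U \<inter> region_near_ones" using U(2) by (simp add: region_near_ones_def)
    show "isCont g p" if "p \<in> U \<inter> region_near_ones" for p
      using holomorphic3_on_isCont[OF U(3)] that by simp
    show "g (s1, s2, s3) = (s1 + s2 + s3 - 3) * Z (s1, s2, s3)"
      if "(s1, s2, s3) \<in> U \<inter> region_near_ones" "s1 + s2 + s3 \<noteq> 3" for s1 s2 s3
    proof -
      have "(s1, s2, s3) \<in> U - polar_set"
        using that polar_set_region_near_ones by blast
      from bspec[OF g this] show ?thesis
        unfolding polar_forms_at_ones by simp
    qed
  qed
qed

section \<open>The limit\<close>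

lemma real_points_tendsto:
  "((\<lambda>\<delta>. (1 + of_real \<delta>, 1 + of_real \<delta>, z) :: complex3) \<longlongrightarrow> (1, 1, z)) (at_right 0)"
  by (auto intro!: tendsto_eq_intros)

theorem theorem1p2:
  fixes \<zeta> :: "complex \<times> complex \<times> complex \<Rightarrow> complex"
  assumes "is_symmetric_zeta \<zeta>"
  shows "((\<lambda>(s1, s2, s3). (s1 + s2 + s3 - 3) * \<zeta> (s1, s2, s3)) \<longlongrightarrow> complex_of_real (pi\<^sup>2 / 4))
           (at (1, 1, 1) within {(s1, s2, s3). s1 + s2 + s3 \<noteq> 3})"
proof -
  obtain U g where U: "open U" "(1, 1, 1) \<in> U" and cont: "\<And>p. p \<in> U \<Longrightarrow> isCont g p"
    and g: "\<And>s1 s2 s3. (s1, s2, s3) \<in> U \<Longrightarrow> s1 + s2 + s3 \<noteq> 3 \<Longrightarrow>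
      g (s1, s2, s3) = (s1 + s2 + s3 - 3) * \<zeta> (s1, s2, s3)"
    by (rule is_symmetric_zeta_local_form[OF assms]) blast
  have g_real: "g (1 + of_real \<delta>, 1 + of_real \<delta>, 1 + of_real t)
      = of_real ((2 * \<delta> + t) * real_series \<delta> t)"
    if "0 < \<delta>" "0 < t" "(1 + of_real \<delta>, 1 + of_real \<delta>, 1 + of_real t) \<in> U" for \<delta> t
  proof -
    have sum: "(1 + of_real \<delta>) + (1 + of_real \<delta>) + (1 + of_real t) - 3 = complex_of_real (2 * \<delta> + t)"
      by simp
    have "complex_of_real (2 * \<delta> + t) \<noteq> 0" using that by (simp only: of_real_eq_0_iff)
    then have "g (1 + of_real \<delta>, 1 + of_real \<delta>, 1 + of_real t)
        = of_real (2 * \<delta> + t) * \<zeta> (1 + of_real \<delta>, 1 + of_real \<delta>, 1 + of_real t)"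
      using g[OF that(3)] unfolding sum[symmetric] by simp
    also have "\<zeta> (1 + of_real \<delta>, 1 + of_real \<delta>, 1 + of_real t)
        = symmetric_zeta_series (1 + of_real \<delta>, 1 + of_real \<delta>, 1 + of_real t)"
      using assms that unfolding is_symmetric_zeta_def by simp
    finally show ?thesis
      using that by (simp add: symmetric_zeta_series_real)
  qed

  \<comment> \<open>The values for \<open>\<delta> = 0\<close>, which lie on the boundary of the region where \<open>\<zeta>\<close> is
    given by its series; they are reached by letting \<open>\<delta>\<close> tend to 0.\<close>
  define h where "h = (\<lambda>t::real. g (1, 1, 1 + of_real t))"
  have path: "((\<lambda>t::real. (1, 1, 1 + of_real t) :: complex3) \<longlongrightarrow> (1, 1, 1)) (at_right 0)"
    by (auto intro!: tendsto_eq_intros)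
  have h_tendsto: "(h \<longlongrightarrow> g (1, 1, 1)) (at_right 0)"
    unfolding h_def using isCont_tendsto_compose[OF cont[OF U(2)] path] .
  have h_U: "eventually (\<lambda>t. (1, 1, 1 + complex_of_real t) \<in> U \<and> 0 < t) (at_right 0)"
    using topological_tendstoD[OF path U(1,2)] eventually_at_right_less
    by (rule eventually_conj)
  have slide: "((\<lambda>\<delta>. of_real ((2 * \<delta> + t) * real_series \<delta> t)) \<longlongrightarrow> h t) (at_right 0)"
    if "(1, 1, 1 + complex_of_real t) \<in> U" "0 < t" for t
  proof (rule Lim_transform_eventually)
    show "((\<lambda>\<delta>. g (1 + of_real \<delta>, 1 + of_real \<delta>, 1 + of_real t)) \<longlongrightarrow> h t) (at_right 0)"
      unfolding h_def by (rule isCont_tendsto_compose[OF cont[OF that(1)] real_points_tendsto])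
    show "eventually (\<lambda>\<delta>. g (1 + of_real \<delta>, 1 + of_real \<delta>, 1 + of_real t)
        = of_real ((2 * \<delta> + t) * real_series \<delta> t)) (at_right 0)"
      using topological_tendstoD[OF real_points_tendsto U(1) that(1)] eventually_at_right_less[of 0]
      by eventually_elim (rule g_real[OF _ that(2)])
  qed
  have h_real: "Im (h t) = 0" and h_upper: "Re (h t) \<le> pi\<^sup>2 / 4"
    and h_lower: "\<And>A. finite A \<Longrightarrow> A \<subseteq> positive_triples \<Longrightarrow> t * (\<Sum>n\<in>A. summand 0 t n) \<le> Re (h t)"
    if t: "(1, 1, 1 + complex_of_real t) \<in> U \<and> 0 < t" for t
  proof -
    have pos: "eventually (\<lambda>\<delta>::real. 0 < \<delta>) (at_right 0)" by (rule eventually_at_right_less)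
    note lim = slide[OF conjunct1[OF t] conjunct2[OF t]]
    show "Im (h t) = 0"
      using tendsto_Im[OF lim] by (simp add: tendsto_const_iff)
    have re: "((\<lambda>\<delta>. (2 * \<delta> + t) * real_series \<delta> t) \<longlongrightarrow> Re (h t)) (at_right 0)"
      using tendsto_Re[OF lim] by simp
    have "((\<lambda>\<delta>. (2 * \<delta> + t) * (pi\<^sup>2 / 4 / t)) \<longlongrightarrow> pi\<^sup>2 / 4) (at_right 0)"
      using t by (auto intro!: tendsto_eq_intros)
    moreover have "eventually (\<lambda>\<delta>. (2 * \<delta> + t) * real_series \<delta> t \<le> (2 * \<delta> + t) * (pi\<^sup>2 / 4 / t)) (at_right 0)"
      using pos
    proof eventually_elim
      case (elim \<delta>)
      then have "real_series \<delta> t \<le> pi\<^sup>2 / 4 / t"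
        using t real_series_upper[of t \<delta>] by (simp add: pos_le_divide_eq mult_ac)
      then show ?case
        using t elim by (intro mult_left_mono) auto
    qed
    ultimately show "Re (h t) \<le> pi\<^sup>2 / 4"
      by (intro tendsto_le[OF _ _ re]) auto
    fix A :: "(nat \<times> nat \<times> nat) set"
    assume A: "finite A" "A \<subseteq> positive_triples"
    have "((\<lambda>\<delta>. summand \<delta> t n) \<longlongrightarrow> summand 0 t n) (at_right 0)" if "n \<in> A" for n
      using A that unfolding summand_def case_prod_beta
      by (auto intro!: tendsto_eq_intros)
    then have "((\<lambda>\<delta>. (2 * \<delta> + t) * (\<Sum>n\<in>A. summand \<delta> t n)) \<longlongrightarrow> (2 * 0 + t) * (\<Sum>n\<in>A. summand 0 t n)) (at_right 0)"
      by (intro tendsto_intros)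
    moreover have "eventually (\<lambda>\<delta>. (2 * \<delta> + t) * (\<Sum>n\<in>A. summand \<delta> t n) \<le> (2 * \<delta> + t) * real_series \<delta> t) (at_right 0)"
      using pos
    proof eventually_elim
      case (elim \<delta>)
      with t A show ?case
        by (intro mult_left_mono real_series_ge_finite_sum) auto
    qed
    ultimately have "(2 * 0 + t) * (\<Sum>n\<in>A. summand 0 t n) \<le> Re (h t)"
      by (intro tendsto_le[OF _ re]) auto
    then show "t * (\<Sum>n\<in>A. summand 0 t n) \<le> Re (h t)" by simp
  qed

  have "g (1, 1, 1) = complex_of_real (pi\<^sup>2 / 4)"
  proof (rule complex_eqI)
    have "((\<lambda>t. Im (h t)) \<longlongrightarrow> 0) (at_right 0)"
      by (rule tendsto_eventually[OF eventually_mono[OF h_U h_real]])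
    from tendsto_unique[OF trivial_limit_at_right_real tendsto_Im[OF h_tendsto] this]
    show "Im (g (1, 1, 1)) = Im (complex_of_real (pi\<^sup>2 / 4))"
      by simp
    have "Re (g (1, 1, 1)) \<le> pi\<^sup>2 / 4"
      by (rule tendsto_upperbound[OF tendsto_Re[OF h_tendsto] eventually_mono[OF h_U h_upper]
            trivial_limit_at_right_real])
    moreover have "c \<le> Re (g (1, 1, 1))" if c: "0 < c" "c < pi\<^sup>2 / 4" for c
    proof -
      obtain M :: nat where M: "1 \<le> M" and lower: "\<forall>t C. 0 < t \<longrightarrow>
          (\<forall>A. finite A \<longrightarrow> A \<subseteq> positive_triples \<longrightarrow> t * (\<Sum>n\<in>A. summand 0 t n) \<le> C) \<longrightarrow>
          c * real M powr - t \<le> C"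
        using sum_summand_lower[OF c(2) less_imp_le[OF c(1)]] by (elim exE conjE)
      have "((\<lambda>t. c * real M powr - t) \<longlongrightarrow> c) (at_right 0)"
        using M by (auto intro!: tendsto_eq_intros)
      moreover have "eventually (\<lambda>t. c * real M powr - t \<le> Re (h t)) (at_right 0)"
        using h_U
      proof eventually_elim
        case (elim t)
        have "\<forall>A. finite A \<longrightarrow> A \<subseteq> positive_triples \<longrightarrow> t * (\<Sum>n\<in>A. summand 0 t n) \<le> Re (h t)"
          by (intro allI impI h_lower[OF elim])
        with lower conjunct2[OF elim] show ?case by (simp only:)
      qed
      ultimately show ?thesis
        by (rule tendsto_le[OF trivial_limit_at_right_real tendsto_Re[OF h_tendsto]])
    qed
    moreover have "(0::real) < pi\<^sup>2 / 4" using pi_gt_zero by (intro divide_pos_pos zero_less_power) auto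
    ultimately have "pi\<^sup>2 / 4 \<le> Re (g (1, 1, 1))" "Re (g (1, 1, 1)) \<le> pi\<^sup>2 / 4"
      by (blast intro: dense_le_bounded)+
    then show "Re (g (1, 1, 1)) = Re (complex_of_real (pi\<^sup>2 / 4))"
      by simp
  qed
  moreover have "(g \<longlongrightarrow> g (1, 1, 1)) (at (1, 1, 1) within {(s1, s2, s3). s1 + s2 + s3 \<noteq> 3})"
    using cont[OF U(2)] unfolding isCont_def by (rule tendsto_within_subset) simp
  ultimately have "(g \<longlongrightarrow> complex_of_real (pi\<^sup>2 / 4))
      (at (1, 1, 1) within {(s1, s2, s3). s1 + s2 + s3 \<noteq> 3})"
    by (simp only:)
  moreover have "eventually (\<lambda>s. g s = (\<lambda>(s1, s2, s3). (s1 + s2 + s3 - 3) * \<zeta> (s1, s2, s3)) s)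
      (at (1, 1, 1) within {(s1, s2, s3). s1 + s2 + s3 \<noteq> 3})"
    unfolding eventually_at_topological
  proof (intro exI[of _ U] conjI ballI impI U)
    fix s :: complex3
    assume "s \<in> U" "s \<in> {(s1, s2, s3). s1 + s2 + s3 \<noteq> 3}"
    then show "g s = (\<lambda>(s1, s2, s3). (s1 + s2 + s3 - 3) * \<zeta> (s1, s2, s3)) s"
      by (cases s) (simp add: g)
  qed
  ultimately show ?thesis
    by (rule Lim_transform_eventually)
qed

end
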